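(* Let $W$ be a one-dimensional random variable and $Z$ a standard normal random variable. Let $r_0\ge1$ be an integer and suppose that $$\mathcal{W}_p(W,Z)\leq A\max_{1\leq r\leq r_0}p^{\alpha_r}\Delta_r\qquad\text{for all } 1\leq p\leq p_0,$$ with some constants $\alpha_1,\dots,\alpha_{r_0}\geq 0$, $A>0$, $p_0\geq 1$ and $\Delta_1,\dots,\Delta_{r_0}>0$. Suppose also that $\overline\Delta:=\max_{1\leq r\leq r_0}\Delta_r$ satisfies $|\log\overline\Delta|\leq p_0/2$. Then there exists a positive constant $C$ depending only on $\alpha_1,\dots,\alpha_{r_0}$ and $A$ such that $$\left|\frac{P(W>x)}{P(Z>x)}-1\right|\leq C(1+x)\left\{\max_{1\leq r\leq r_0}(|\log\overline\Delta|+x^2)^{\alpha_r}\Delta_r+\overline\Delta\right\}$$ for all $0\leq x\leq \min\Big\{\sqrt{p_0},\ \min_{1\le r\le r_0}\Delta_r^{-1/(2\alpha_r+1)}\Big\}$.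
   Context: For real random variables $X,Y$ and $p\ge1$, $\mathcal{W}_p(X,Y)=\big(\inf_\pi\int|x-y|^p\,\pi(dx,dy)\big)^{1/p}$, the infimum being over all probability measures $\pi$ on $\mathbb{R}\times\mathbb{R}$ with marginals the laws of $X$ and $Y$ ($p$-Wasserstein distance). *)

theory Defs
  imports "HOL-Probability.Probability"
begin

text \<open>A random variable enters only through its law, a probability measure on the Borel sets of
  the real line (locale \<^locale>\<open>real_distribution\<close>).\<close>

definition couplings :: "real measure \<Rightarrow> real measure \<Rightarrow> (real \<times> real) measure set" where
  "couplings \<mu> \<nu> =
     {\<pi>. prob_space \<pi> \<and> sets \<pi> = sets (borel \<Otimes>\<^sub>M borel) \<and>
         distr \<pi> borel fst = \<mu> \<and> distr \<pi> borel snd = \<nu>}"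

text \<open>Only used for positive exponents \<open>a\<close>, where \<open>\<infinity>\<close> to the power \<open>a\<close> is \<open>\<infinity>\<close>.\<close>

definition ennreal_powr :: "ennreal \<Rightarrow> real \<Rightarrow> ennreal" where
  "ennreal_powr x a = (if x = \<infinity> then \<infinity> else ennreal (enn2real x powr a))"

text \<open>Extended-valued: the distance is \<open>\<infinity>\<close> if every coupling has infinite cost, so a real upper
  bound on it includes the claim that it is finite.\<close>

definition wasserstein :: "real \<Rightarrow> real measure \<Rightarrow> real measure \<Rightarrow> ennreal" where
  "wasserstein p \<mu> \<nu> =
     ennreal_powr
       (INF \<pi>\<in>couplings \<mu> \<nu>. \<integral>\<^sup>+z. ennreal (\<bar>fst z - snd z\<bar> powr p) \<partial>\<pi>) (1 / p)"

text \<open>Power of a nonnegative base with the convention that the zeroth power of 0 is 1, whereas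
  \<^term>\<open>0 powr 0 = (0::real)\<close>. This matters for \<open>\<bar>log \<Delta>\<bar> + x\<^sup>2\<close>, which may vanish.\<close>

definition rpow :: "real \<Rightarrow> real \<Rightarrow> real" where
  "rpow b a = (if a = 0 then 1 else b powr a)"

end

theory Submission
  imports Defs
begin

text \<open>
  A bound on \<open>\<W>\<^sub>p(W,Z)\<close> becomes a bound on tails through Markov's inequality: if a coupling moves
  mass so little that \<open>E |W - Z|\<^sup>p \<le> c\<^sup>p\<close>, then \<open>|W - Z|\<close> exceeds \<open>\<epsilon> = e c\<close> with probability at most
  \<open>e\<^bsup>-p\<^esup>\<close>, so that \<open>P(W > x)\<close> lies between \<open>P(Z > x + \<epsilon>)\<close> and \<open>P(Z > x - \<epsilon>)\<close> up to an error
  \<open>e\<^bsup>-p\<^esup>\<close>. Shifting the Gaussian tail by \<open>\<epsilon>\<close> costs at most \<open>\<epsilon> \<phi>(x) e\<^bsup>x\<epsilon>\<^esup>\<close>, where \<open>\<phi>\<close> is the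
  standard normal density, and the Mills ratio bound \<open>P(Z > x) \<ge> e\<^bsup>-3/2\<^esup> \<phi>(x) / (1 + x)\<close> turns these
  absolute errors into relative ones. The result is \<open>tail_ratio_le_of_wasserstein\<close>.

  The exponent \<open>p\<close> is then chosen so that \<open>e\<^bsup>-p\<^esup> \<le> \<Delta> e\<^bsup>-x\<^sup>2/2\<^esup>\<close> for \<open>\<Delta> = max \<Delta>\<^sub>r\<close>, which makes the
  Markov error contribute just the term \<open>\<Delta>\<close> of the claim: for \<open>\<Delta> < 1\<close> this is
  \<open>p = max 1 (|log \<Delta>| + x\<^sup>2/2)\<close>, and \<open>p \<le> p\<^sub>0\<close> since both \<open>|log \<Delta>| \<le> p\<^sub>0/2\<close> and \<open>x\<^sup>2 \<le> p\<^sub>0\<close>. With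
  this choice \<open>\<epsilon>\<close> is of the order of the bracket in the claim. It remains to keep \<open>e\<^bsup>x\<epsilon>\<^esup>\<close> bounded,
  that is, to bound \<open>x p\<^bsup>\<alpha>\<^esup> \<Delta>\<^sub>r\<close>; this is where \<open>x \<le> \<Delta>\<^sub>r\<^bsup>-1/(2\<alpha>+1)\<^esup>\<close> enters
  (\<open>shift_product_bounded\<close>). For \<open>\<Delta> \<ge> 1\<close> the condition forces \<open>x \<le> 1\<close>, and the claim is trivial
  because the tail ratio is bounded.
\<close>

section \<open>From Wasserstein distance to tail comparison\<close>

text \<open>The strict inequality \<open>b < c\<close> lets an almost optimal coupling serve, which exists by the mere
  definition of an infimum.\<close>

lemma coupling_of_wasserstein_le:
  assumes p: "p > 0" and b: "0 \<le> b" "b < c"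
    and W: "wasserstein p \<mu> \<nu> \<le> ennreal b"
  obtains \<pi> where "\<pi> \<in> couplings \<mu> \<nu>"
    "(\<integral>\<^sup>+z. ennreal (\<bar>fst z - snd z\<bar> powr p) \<partial>\<pi>) \<le> ennreal (c powr p)"
proof -
  define I where "I = (INF \<pi>\<in>couplings \<mu> \<nu>. \<integral>\<^sup>+z. ennreal (\<bar>fst z - snd z\<bar> powr p) \<partial>\<pi>)"
  have le: "ennreal_powr I (1/p) \<le> ennreal b"
    using W by (simp add: wasserstein_def I_def)
  then have fin: "I \<noteq> \<infinity>"
    by (auto simp: ennreal_powr_def top_unique split: if_splits)
  with le have "enn2real I powr (1/p) \<le> b"
    using b by (simp add: ennreal_powr_def)
  then have "(enn2real I powr (1/p)) powr p \<le> b powr p"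
    using p by (intro powr_mono2) auto
  also have "\<dots> < c powr p"
    using b p by (intro powr_less_mono2) auto
  finally have "enn2real I < c powr p"
    using p by (simp add: powr_powr)
  then have "I < ennreal (c powr p)"
    using fin by (metis enn2real_nonneg ennreal_enn2real ennreal_lessI infinity_ennreal_def
        le_less_trans top.not_eq_extremum)
  then show thesis
    using that unfolding I_def INF_less_iff by (metis less_imp_le)
qed

text \<open>Markov's inequality at the level \<open>e c\<close>, where the quotient \<open>(c / (e c))\<^sup>p\<close> is \<open>e\<^bsup>-p\<^esup>\<close>.\<close>

lemma coupling_distance_tail_le:
  assumes p: "p > 0" and c: "c > 0" and \<pi>: "\<pi> \<in> couplings \<mu> \<nu>"
    and cost: "(\<integral>\<^sup>+z. ennreal (\<bar>fst z - snd z\<bar> powr p) \<partial>\<pi>) \<le> ennreal (c powr p)"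
  shows "measure \<pi> {z. exp 1 * c \<le> \<bar>fst z - snd z\<bar>} \<le> exp (- p)"
proof -
  interpret prob_space \<pi> using \<pi> by (simp add: couplings_def)
  have sets[measurable_cong]: "sets \<pi> = sets (borel \<Otimes>\<^sub>M borel)"
    using \<pi> by (simp add: couplings_def)
  have sp: "space \<pi> = UNIV"
    using sets_eq_imp_space_eq[OF sets] by (simp add: space_pair_measure)
  define k where "k = (exp 1 * c) powr (-p)"
  have "{z. exp 1 * c \<le> \<bar>fst z - snd z\<bar>}
      \<subseteq> {z\<in>space \<pi>. 1 \<le> ennreal k * ennreal (\<bar>fst z - snd z\<bar> powr p)}"
  proof safe
    fix z :: "real \<times> real" assume "exp 1 * c \<le> \<bar>fst z - snd z\<bar>"
    then have "(exp 1 * c) powr p \<le> \<bar>fst z - snd z\<bar> powr p"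
      using p c by (intro powr_mono2) auto
    then have "k * (exp 1 * c) powr p \<le> k * \<bar>fst z - snd z\<bar> powr p"
      by (intro mult_left_mono) (auto simp: k_def)
    moreover have "k * (exp 1 * c) powr p = 1"
      using c by (simp add: k_def flip: powr_add)
    ultimately show "1 \<le> ennreal k * ennreal (\<bar>fst z - snd z\<bar> powr p)"
      by (simp add: k_def flip: ennreal_mult)
  qed (simp add: sp)
  then have "emeasure \<pi> {z. exp 1 * c \<le> \<bar>fst z - snd z\<bar>}
      \<le> emeasure \<pi> {z\<in>space \<pi>. 1 \<le> ennreal k * ennreal (\<bar>fst z - snd z\<bar> powr p)}"
    by (intro emeasure_mono) measurable
  also have "\<dots> \<le> ennreal k * (\<integral>\<^sup>+z. ennreal (\<bar>fst z - snd z\<bar> powr p) * indicator (space \<pi>) z \<partial>\<pi>)"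
    by (intro nn_integral_Markov_inequality) measurable
  also have "\<dots> = ennreal k * (\<integral>\<^sup>+z. ennreal (\<bar>fst z - snd z\<bar> powr p) \<partial>\<pi>)"
    by (simp add: sp)
  also have "\<dots> \<le> ennreal k * ennreal (c powr p)"
    by (intro mult_left_mono cost) auto
  also have "\<dots> = ennreal (k * c powr p)"
    by (simp add: k_def ennreal_mult)
  also have "k * c powr p = exp (- p)"
    using c by (simp add: k_def powr_def ln_mult algebra_simps flip: exp_add)
  finally show ?thesis
    by (simp add: emeasure_eq_measure)
qed

text \<open>Off the event that the coupled coordinates are at least \<open>\<epsilon> = 2 e b\<close> apart, one of them
  exceeding a level forces the other to exceed that level less \<open>\<epsilon>\<close>. The factor \<open>2\<close> pays for using a
  coupling that is optimal only up to that factor.\<close>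

lemma tail_comparison_of_wasserstein_le:
  assumes p: "p > 0" and b: "b > 0" and W: "wasserstein p \<mu> \<nu> \<le> ennreal b"
  shows "measure \<mu> {x<..} \<le> measure \<nu> {x - 2 * exp 1 * b<..} + exp (- p)"
    and "measure \<nu> {x + 2 * exp 1 * b<..} \<le> measure \<mu> {x<..} + exp (- p)"
proof -
  obtain \<pi> where \<pi>: "\<pi> \<in> couplings \<mu> \<nu>"
    and cost: "(\<integral>\<^sup>+z. ennreal (\<bar>fst z - snd z\<bar> powr p) \<partial>\<pi>) \<le> ennreal ((2 * b) powr p)"
    using coupling_of_wasserstein_le[OF p, of b "2 * b"] b W by auto
  interpret prob_space \<pi> using \<pi> by (simp add: couplings_def)
  have sets[measurable_cong]: "sets \<pi> = sets (borel \<Otimes>\<^sub>M borel)"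
    using \<pi> by (simp add: couplings_def)
  have sp: "space \<pi> = UNIV"
    using sets_eq_imp_space_eq[OF sets] by (simp add: space_pair_measure)
  have meas: "{z. P z} \<in> sets \<pi>" if "Measurable.pred \<pi> P" for P
    using that by (simp add: pred_def sp)
  define D where "D = {z :: real \<times> real. exp 1 * (2 * b) \<le> \<bar>fst z - snd z\<bar>}"
  have D: "measure \<pi> D \<le> exp (- p)"
    using coupling_distance_tail_le[OF p _ \<pi> cost] b by (simp add: D_def)
  have Ds: "D \<in> sets \<pi>"
    unfolding D_def by (intro meas) measurable
  have \<mu>: "measure \<mu> {y<..} = measure \<pi> {z. y < fst z}" for y
  proof -
    have "distr \<pi> borel fst = \<mu>" using \<pi> by (simp add: couplings_def)
    then have "measure \<mu> {y<..} = measure (distr \<pi> borel fst) {y<..}" by simp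
    also have "\<dots> = measure \<pi> (fst -` {y<..} \<inter> space \<pi>)"
      by (rule measure_distr) measurable
    finally show ?thesis by (simp add: sp vimage_def)
  qed
  have \<nu>: "measure \<nu> {y<..} = measure \<pi> {z. y < snd z}" for y
  proof -
    have "distr \<pi> borel snd = \<nu>" using \<pi> by (simp add: couplings_def)
    then have "measure \<nu> {y<..} = measure (distr \<pi> borel snd) {y<..}" by simp
    also have "\<dots> = measure \<pi> (snd -` {y<..} \<inter> space \<pi>)"
      by (rule measure_distr) measurable
    finally show ?thesis by (simp add: sp vimage_def)
  qed
  have f: "{z. y < fst z} \<in> sets \<pi>" and s: "{z. y < snd z} \<in> sets \<pi>" for y
    by (intro meas; measurable)+
  have "measure \<pi> {z. x < fst z} \<le> measure \<pi> ({z. x - 2 * exp 1 * b < snd z} \<union> D)"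
    using s Ds by (intro finite_measure_mono) (auto simp: D_def)
  also have "\<dots> \<le> measure \<pi> {z. x - 2 * exp 1 * b < snd z} + measure \<pi> D"
    by (intro measure_Un_le s Ds)
  finally show "measure \<mu> {x<..} \<le> measure \<nu> {x - 2 * exp 1 * b<..} + exp (- p)"
    using D by (simp add: \<mu> \<nu>)
  have "measure \<pi> {z. x + 2 * exp 1 * b < snd z} \<le> measure \<pi> ({z. x < fst z} \<union> D)"
    using f Ds by (intro finite_measure_mono) (auto simp: D_def)
  also have "\<dots> \<le> measure \<pi> {z. x < fst z} + measure \<pi> D"
    by (intro measure_Un_le f Ds)
  finally show "measure \<nu> {x + 2 * exp 1 * b<..} \<le> measure \<mu> {x<..} + exp (- p)"
    using D by (simp add: \<mu> \<nu>)
qed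

section \<open>Gaussian tails\<close>

interpretation std_normal: real_distribution std_normal_distribution
  by (rule real_dist_normal_dist)

lemma std_normal_interval_le:
  assumes "a \<le> b" "\<And>t. t \<in> {a<..b} \<Longrightarrow> std_normal_density t \<le> M" "0 \<le> M"
  shows "measure std_normal_distribution {a<..b} \<le> M * (b - a)"
proof -
  have "emeasure std_normal_distribution {a<..b}
      = (\<integral>\<^sup>+t. ennreal (std_normal_density t) * indicator {a<..b} t \<partial>lborel)"
    by (rule emeasure_density) auto
  also have "\<dots> \<le> (\<integral>\<^sup>+t. ennreal M * indicator {a<..b} t \<partial>lborel)"
    using assms by (intro nn_integral_mono) (auto split: split_indicator intro!: ennreal_leI)
  also have "\<dots> = ennreal (M * (b - a))"
    using assms by (simp add: nn_integral_cmult_indicator ennreal_mult)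
  finally show ?thesis
    using assms by (simp add: std_normal.emeasure_eq_measure)
qed

lemma std_normal_interval_ge:
  assumes "a \<le> b" "\<And>t. t \<in> {a<..b} \<Longrightarrow> m \<le> std_normal_density t" "0 \<le> m"
  shows "m * (b - a) \<le> measure std_normal_distribution {a<..b}"
proof -
  have "ennreal (m * (b - a)) = (\<integral>\<^sup>+t. ennreal m * indicator {a<..b} t \<partial>lborel)"
    using assms by (simp add: nn_integral_cmult_indicator ennreal_mult)
  also have "\<dots> \<le> (\<integral>\<^sup>+t. ennreal (std_normal_density t) * indicator {a<..b} t \<partial>lborel)"
    using assms by (intro nn_integral_mono) (auto split: split_indicator intro!: ennreal_leI)
  also have "\<dots> = emeasure std_normal_distribution {a<..b}"
    by (rule emeasure_density[symmetric]) auto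
  finally show ?thesis
    using assms by (simp add: std_normal.emeasure_eq_measure)
qed

lemma std_normal_tail_split:
  assumes "a \<le> b"
  shows "measure std_normal_distribution {a<..}
    = measure std_normal_distribution {a<..b} + measure std_normal_distribution {b<..}"
proof -
  have "measure std_normal_distribution ({a<..b} \<union> {b<..})
    = measure std_normal_distribution {a<..b} + measure std_normal_distribution {b<..}"
    by (intro std_normal.finite_measure_Union) auto
  also have "{a<..b} \<union> {b<..} = {a<..}" using assms by auto
  finally show ?thesis .
qed

text \<open>The density at \<open>x - s\<close> with \<open>0 \<le> s \<le> \<epsilon>\<close> is \<open>\<phi>(x) e\<^bsup>xs - s\<^sup>2/2\<^esup>\<close>, at most \<open>\<phi>(x) e\<^bsup>x\<epsilon>\<^esup>\<close>.\<close>

lemma std_normal_tail_shift_left: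
  assumes "0 \<le> x" "0 \<le> \<epsilon>"
  shows "measure std_normal_distribution {x - \<epsilon><..}
    \<le> measure std_normal_distribution {x<..} + std_normal_density x * exp (x * \<epsilon>) * \<epsilon>"
proof -
  have "std_normal_density t \<le> std_normal_density x * exp (x * \<epsilon>)" if "t \<in> {x - \<epsilon><..x}" for t
  proof -
    have "x * (x - t) \<le> x * \<epsilon>"
      using assms that by (intro mult_left_mono) auto
    moreover have "- t\<^sup>2 / 2 = - x\<^sup>2 / 2 + x * (x - t) - (x - t)\<^sup>2 / 2"
      by (simp add: power2_eq_square field_simps)
    ultimately have "- t\<^sup>2 / 2 \<le> - x\<^sup>2 / 2 + x * \<epsilon>"
      using zero_le_power2[of "x - t"] by linarith
    then have "exp (- t\<^sup>2 / 2) \<le> exp (- x\<^sup>2 / 2) * exp (x * \<epsilon>)"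
      by (simp flip: exp_add)
    then show ?thesis
      by (simp add: std_normal_density_def divide_right_mono)
  qed
  then have "measure std_normal_distribution {x - \<epsilon><..x}
      \<le> (std_normal_density x * exp (x * \<epsilon>)) * (x - (x - \<epsilon>))"
    using assms by (intro std_normal_interval_le) auto
  then show ?thesis
    using std_normal_tail_split[of "x - \<epsilon>" x] assms by simp
qed

lemma std_normal_density_antimono:
  assumes "0 \<le> x" "x \<le> y"
  shows "std_normal_density y \<le> std_normal_density x"
  using power_mono[OF assms(2,1), of 2] by (simp add: std_normal_density_def divide_right_mono)

lemma std_normal_tail_shift_right:
  assumes "0 \<le> x" "0 \<le> \<epsilon>"
  shows "measure std_normal_distribution {x<..}
    \<le> measure std_normal_distribution {x + \<epsilon><..} + std_normal_density x * \<epsilon>"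
proof -
  have "measure std_normal_distribution {x<..x + \<epsilon>} \<le> std_normal_density x * (x + \<epsilon> - x)"
    using assms by (intro std_normal_interval_le std_normal_density_antimono) auto
  then show ?thesis
    using std_normal_tail_split[of x "x + \<epsilon>"] assms by simp
qed

text \<open>The interval of length \<open>1/(1+x)\<close> to the right of \<open>x\<close> already has this much mass: over it,
  \<open>t\<^sup>2 \<le> x\<^sup>2 + 3\<close>, so the density drops by a factor \<open>e\<^bsup>-3/2\<^esup>\<close> at most.\<close>

lemma std_normal_tail_ge:
  assumes "0 \<le> x"
  shows "exp (- 3 / 2) * std_normal_density x / (1 + x) \<le> measure std_normal_distribution {x<..}"
proof -
  define h where "h = 1 / (1 + x)"
  have h: "0 \<le> h" "h \<le> 1" "x * h \<le> 1"
    using assms by (auto simp: h_def)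
  have "exp (- 3 / 2) * std_normal_density x \<le> std_normal_density t" if "t \<in> {x<..x + h}" for t
  proof -
    have "t\<^sup>2 \<le> (x + h)\<^sup>2"
      using that assms by (intro power_mono) auto
    also have "\<dots> = x\<^sup>2 + 2 * (x * h) + h * h"
      by (simp add: power2_eq_square algebra_simps)
    also have "\<dots> \<le> x\<^sup>2 + 3"
      using h mult_mono[of h 1 h 1] by linarith
    finally have "exp (- 3 / 2) * exp (- x\<^sup>2 / 2) \<le> exp (- t\<^sup>2 / 2)"
      by (simp flip: exp_add)
    then show ?thesis
      by (simp add: std_normal_density_def divide_right_mono)
  qed
  then have "(exp (- 3 / 2) * std_normal_density x) * (x + h - x)
      \<le> measure std_normal_distribution {x<..x + h}"
    using h by (intro std_normal_interval_ge) auto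
  also have "\<dots> \<le> measure std_normal_distribution {x<..}"
    by (intro std_normal.finite_measure_mono) auto
  finally show ?thesis
    by (simp add: h_def)
qed

lemma std_normal_tail_pos:
  assumes "0 \<le> x"
  shows "0 < measure std_normal_distribution {x<..}"
proof -
  have "0 < exp (- 3 / 2) * std_normal_density x / (1 + x)"
    using assms by (intro divide_pos_pos mult_pos_pos) (auto simp: normal_density_pos)
  then show ?thesis
    using std_normal_tail_ge[OF assms] by linarith
qed

lemma exp_over_std_normal_tail_le:
  assumes "0 \<le> x"
  shows "exp a / measure std_normal_distribution {x<..}
    \<le> exp (3 / 2) * (1 + x) * (sqrt (2 * pi) * exp (a + x\<^sup>2 / 2))"
proof -
  have "exp a / measure std_normal_distribution {x<..}
      \<le> exp a / (exp (- 3 / 2) * std_normal_density x / (1 + x))"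
    using assms
    by (intro divide_left_mono std_normal_tail_ge mult_pos_pos divide_pos_pos std_normal_tail_pos)
      (auto simp: normal_density_pos)
  also have "\<dots> = exp (3 / 2) * (1 + x) * (sqrt (2 * pi) * exp (a + x\<^sup>2 / 2))"
    using assms unfolding std_normal_density_def exp_add by (simp add: exp_minus divide_simps)
  finally show ?thesis .
qed

lemma std_normal_density_over_tail_le:
  assumes "0 \<le> x"
  shows "std_normal_density x / measure std_normal_distribution {x<..} \<le> exp (3 / 2) * (1 + x)"
proof -
  have "std_normal_density x \<le> measure std_normal_distribution {x<..} * (exp (3 / 2) * (1 + x))"
    using std_normal_tail_ge[OF assms] assms by (simp add: exp_minus divide_simps mult_ac)
  then show ?thesis
    using std_normal_tail_pos[OF assms] by (simp add: divide_le_eq mult_ac)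
qed

section \<open>Relative error of the tail\<close>

text \<open>The first summand is the cost of shifting the Gaussian tail by \<open>2 e b\<close>, the second one the Markov
  error, both divided by the tail. Taking \<open>p\<close> larger than \<open>x\<^sup>2/2\<close> is what makes the second one
  small.\<close>

lemma tail_ratio_le_of_wasserstein:
  assumes p: "p > 0" and b: "b > 0" and x: "0 \<le> x"
    and W: "wasserstein p \<mu> std_normal_distribution \<le> ennreal b"
  shows "\<bar>measure \<mu> {x<..} / measure std_normal_distribution {x<..} - 1\<bar>
    \<le> exp (3 / 2) * (1 + x)
       * (2 * exp 1 * b * exp (x * (2 * exp 1 * b)) + sqrt (2 * pi) * exp (x\<^sup>2 / 2 - p))"
proof -
  define \<epsilon> where "\<epsilon> = 2 * exp 1 * b"
  define Q where "Q = measure std_normal_distribution {x<..}"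
  have \<epsilon>: "0 \<le> \<epsilon>" and Q: "Q > 0"
    using b x by (simp_all add: \<epsilon>_def Q_def std_normal_tail_pos)
  have "std_normal_density x * \<epsilon> \<le> std_normal_density x * exp (x * \<epsilon>) * \<epsilon>"
    using x \<epsilon> mult_left_mono[of 1 "exp (x * \<epsilon>)" "std_normal_density x"]
    by (intro mult_right_mono) auto
  then have "\<bar>measure \<mu> {x<..} - Q\<bar> \<le> std_normal_density x * exp (x * \<epsilon>) * \<epsilon> + exp (- p)"
    using tail_comparison_of_wasserstein_le[OF p b W, of x, folded \<epsilon>_def]
      std_normal_tail_shift_left[OF x \<epsilon>] std_normal_tail_shift_right[OF x \<epsilon>]
    unfolding Q_def by linarith
  then have "\<bar>measure \<mu> {x<..} - Q\<bar> / Q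
      \<le> (std_normal_density x * exp (x * \<epsilon>) * \<epsilon> + exp (- p)) / Q"
    using Q by (intro divide_right_mono) auto
  also have "\<dots> = (std_normal_density x / Q) * (\<epsilon> * exp (x * \<epsilon>)) + exp (- p) / Q"
    by (simp add: add_divide_distrib mult_ac)
  also have "\<dots> \<le> exp (3 / 2) * (1 + x) * (\<epsilon> * exp (x * \<epsilon>))
      + exp (3 / 2) * (1 + x) * (sqrt (2 * pi) * exp (- p + x\<^sup>2 / 2))"
    unfolding Q_def using x \<epsilon>
    by (intro add_mono mult_right_mono std_normal_density_over_tail_le
        exp_over_std_normal_tail_le) auto
  also have "\<dots> = exp (3 / 2) * (1 + x) * (\<epsilon> * exp (x * \<epsilon>) + sqrt (2 * pi) * exp (x\<^sup>2 / 2 - p))"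
    by (simp add: algebra_simps)
  also have "\<bar>measure \<mu> {x<..} - Q\<bar> / Q = \<bar>measure \<mu> {x<..} / Q - 1\<bar>"
    using Q by (simp add: field_simps)
  finally show ?thesis
    by (simp add: \<epsilon>_def Q_def)
qed

text \<open>Here both tails lie in \<open>[0,1]\<close> and the Gaussian one is bounded below by a constant
  multiple of \<open>1 / (1 + x)\<close>.\<close>

lemma tail_ratio_le_near_zero:
  assumes \<mu>: "prob_space \<mu>" and x: "0 \<le> x" "x \<le> 1"
  shows "\<bar>measure \<mu> {x<..} / measure std_normal_distribution {x<..} - 1\<bar>
    \<le> exp 2 * sqrt (2 * pi) * (1 + x)"
proof -
  define Q where "Q = measure std_normal_distribution {x<..}"
  have Q: "0 < Q" "Q \<le> 1"
    using x by (simp_all add: Q_def std_normal_tail_pos)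
  have "\<bar>measure \<mu> {x<..} - Q\<bar> \<le> 1"
    using Q prob_space.prob_le_1[OF \<mu>, of "{x<..}"] measure_nonneg[of \<mu> "{x<..}"]
    unfolding abs_le_iff by linarith
  then have "\<bar>measure \<mu> {x<..} - Q\<bar> / Q \<le> exp 0 / Q"
    using Q by (intro divide_right_mono) auto
  also have "\<dots> \<le> exp (3 / 2) * (1 + x) * (sqrt (2 * pi) * exp (0 + x\<^sup>2 / 2))"
    unfolding Q_def by (rule exp_over_std_normal_tail_le[OF x(1)])
  also have "\<dots> \<le> exp (3 / 2) * (1 + x) * (sqrt (2 * pi) * exp (1 / 2))"
    using x by (intro mult_left_mono) (auto simp: power_le_one)
  also have "\<dots> = exp (3 / 2 + 1 / 2) * sqrt (2 * pi) * (1 + x)"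
    unfolding exp_add by simp
  also have "\<bar>measure \<mu> {x<..} - Q\<bar> / Q = \<bar>measure \<mu> {x<..} / Q - 1\<bar>"
    using Q by (simp add: field_simps)
  finally show ?thesis
    by (simp add: Q_def)
qed

section \<open>The choice of the exponent\<close>

text \<open>As \<open>L + x\<^sup>2/2 \<le> max (2L) (x\<^sup>2)\<close>, one of \<open>p \<le> 1\<close>, \<open>p \<le> 2L\<close> and \<open>p \<le> x\<^sup>2\<close> holds. The
  condition on \<open>x\<close> can be read as \<open>x\<^bsup>2a+1\<^esup> d \<le> 1\<close>, which settles the last case. It also gives
  \<open>x d \<le> d\<^bsup>q\<^esup> \<le> e\<^bsup>-Lq\<^esup>\<close> with \<open>q = 2a/(2a+1)\<close>. This settles the first case, and in the second the
  exponential beats \<open>(2L)\<^bsup>a\<^esup>\<close> because \<open>q\<close> vanishes only together with \<open>a\<close>.\<close>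

lemma shift_product_bounded:
  fixes a d L p x :: real
  assumes a: "a \<ge> 0" and d: "0 < d" "d \<le> exp (- L)" and L: "L \<ge> 0"
    and x: "0 \<le> x" "x \<le> d powr (- 1 / (2 * a + 1))"
    and p: "p \<ge> 1" "p \<le> max 1 (L + x\<^sup>2 / 2)"
  shows "x * (p powr a * d) \<le> (2 * a + 1) powr a"
proof -
  have one: "1 \<le> (2 * a + 1) powr a"
    using a by (intro ge_one_powr_ge_zero) auto
  define q where "q = 2 * a / (2 * a + 1)"
  have q: "q \<ge> 0" "1 - 1 / (2 * a + 1) = q"
    using a by (auto simp: q_def field_simps)
  have "x * d \<le> d powr (- 1 / (2 * a + 1)) * d powr 1"
    using d x by (intro mult_mono) auto
  also have "\<dots> = d powr q"
    unfolding powr_add[symmetric] q(2)[symmetric] by simp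
  also have "\<dots> \<le> exp (- L) powr q"
    using d q by (intro powr_mono2) auto
  finally have xd: "x * d \<le> exp (- L * q)"
    by (simp add: powr_def mult_ac)
  consider "p \<le> 1" | "p \<le> 2 * L" | "p \<le> x\<^sup>2"
    using p(2) unfolding le_max_iff_disj by linarith
  then show ?thesis
  proof cases
    case 1
    then have "x * (p powr a * d) = x * d"
      using p by simp
    also have "\<dots> \<le> 1"
      using xd L q by (meson exp_le_one_iff mult_nonpos_nonneg neg_le_0_iff_le order_trans)
    finally show ?thesis
      using one by linarith
  next
    case 2
    (* Chosen so that e^(-Lq) = (e^(-u))^a, and u <= e^u compares the bases of the a-th powers. *)
    define u where "u = 2 * L / (2 * a + 1)"
    have u: "u \<ge> 0" "2 * L = (2 * a + 1) * u" "L * q = u * a"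
      using L a by (auto simp: u_def q_def field_simps)
    have "x * (p powr a * d) = p powr a * (x * d)"
      by simp
    also have "\<dots> \<le> ((2 * a + 1) * u) powr a * exp (- (u * a))"
      using 2 p a xd x d u by (intro mult_mono powr_mono2) auto
    also have "\<dots> = (2 * a + 1) powr a * (u powr a * exp (- (u * a)))"
      using u a by (simp add: powr_mult)
    also have "\<dots> \<le> (2 * a + 1) powr a * (exp u powr a * exp (- (u * a)))"
      using u a order_trans[OF _ exp_ge_add_one_self[of u], of u]
      by (intro mult_left_mono mult_right_mono powr_mono2) auto
    also have "exp u powr a * exp (- (u * a)) = 1"
      by (simp add: powr_def mult_ac flip: exp_add)
    finally show ?thesis
      by simp
  next
    case 3
    then have "x > 0"
      using p x by (cases "x = 0") auto
    have "x * (p powr a * d) \<le> x * ((x\<^sup>2) powr a * d)"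
      using 3 p a d x by (intro mult_left_mono mult_right_mono powr_mono2) auto
    also have "\<dots> = x powr (2 * a + 1) * d"
      using \<open>x > 0\<close> by (simp add: powr_add powr_powr flip: powr_numeral)
    also have "\<dots> \<le> (d powr (- 1 / (2 * a + 1))) powr (2 * a + 1) * d"
      using x a d by (intro mult_right_mono powr_mono2) auto
    also have "\<dots> = d powr (- 1) * d"
      using a unfolding powr_powr by simp
    also have "\<dots> = 1"
      using d by (simp add: powr_minus)
    finally show ?thesis
      using one by linarith
  qed
qed

text \<open>Raising the exponent to \<open>1\<close> may make it larger than \<open>s = L + x\<^sup>2\<close>, but then its powers are \<open>1\<close>,
  and the extra term \<open>D = \<Delta>\<close> of the claim absorbs them.\<close>

lemma max_one_powr_mult_le:
  fixes a d D s :: real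
  assumes "a \<ge> 0" "0 < d" "d \<le> D" "t \<ge> 0" "t \<le> s"
  shows "max 1 t powr a * d \<le> s powr a * d + D"
proof (cases "t \<le> 1")
  case True
  then show ?thesis using assms by (simp add: max_def add_increasing)
next
  case False
  have "t powr a * d \<le> s powr a * d"
    using assms by (intro mult_right_mono powr_mono2) auto
  then have "t powr a * d \<le> s powr a * d + D"
    using assms by linarith
  then show ?thesis using False by (simp add: max_def)
qed

lemma rpow_eq_powr: "b > 0 \<Longrightarrow> rpow b a = b powr a"
  by (simp add: rpow_def)

lemma rpow_nonneg: "0 \<le> rpow b a"
  by (simp add: rpow_def)

theorem theorem2p2:
  fixes r0 :: nat and \<alpha> :: "nat \<Rightarrow> real" and A :: real
  assumes "r0 \<ge> 1" and "\<And>r. r \<in> {1..r0} \<Longrightarrow> \<alpha> r \<ge> 0" and "A > 0"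
  shows "\<exists>C>0. \<forall>(W :: real measure) (p0 :: real) (\<Delta> :: nat \<Rightarrow> real) (\<Delta>max :: real).
    real_distribution W \<longrightarrow>
    p0 \<ge> 1 \<longrightarrow>
    (\<forall>r\<in>{1..r0}. \<Delta> r > 0) \<longrightarrow>
    \<Delta>max = (MAX r\<in>{1..r0}. \<Delta> r) \<longrightarrow>
    (\<forall>p. 1 \<le> p \<and> p \<le> p0 \<longrightarrow>
       wasserstein p W std_normal_distribution
         \<le> ennreal (A * (MAX r\<in>{1..r0}. rpow p (\<alpha> r) * \<Delta> r))) \<longrightarrow>
    \<bar>ln \<Delta>max\<bar> \<le> p0 / 2 \<longrightarrow>
    (\<forall>x. 0 \<le> x \<and> x \<le> min (sqrt p0) (MIN r\<in>{1..r0}. \<Delta> r powr (- 1 / (2 * \<alpha> r + 1))) \<longrightarrow>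
       \<bar>measure W {x<..} / measure std_normal_distribution {x<..} - 1\<bar>
         \<le> C * (1 + x) *
             ((MAX r\<in>{1..r0}. rpow (\<bar>ln \<Delta>max\<bar> + x\<^sup>2) (\<alpha> r) * \<Delta> r) + \<Delta>max))"
proof -
  (* C1 serves max \<Delta> < 1, where K bounds x times the Wasserstein bound up to A; C2 serves the rest. *)
  define K where "K = (MAX r\<in>{1..r0}. (2 * \<alpha> r + 1) powr \<alpha> r)"
  define C1 where "C1 = exp (3 / 2) * (2 * exp 1 * A * exp (2 * exp 1 * A * K) + sqrt (2 * pi))"
  define C2 where "C2 = exp 2 * sqrt (2 * pi)"
  have C: "C1 > 0" "C2 > 0"
    using \<open>A > 0\<close> by (auto simp: C1_def C2_def intro!: mult_pos_pos add_pos_pos)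
  have ne: "{1..r0} \<noteq> {}" using \<open>r0 \<ge> 1\<close> by auto
  show ?thesis
  proof (intro exI[of _ "max C1 C2"] conjI allI impI)
    fix W :: "real measure" and p0 :: real and \<Delta> :: "nat \<Rightarrow> real" and \<Delta>max x :: real
    assume W: "real_distribution W" and p0: "p0 \<ge> 1"
      and \<Delta>: "\<forall>r\<in>{1..r0}. \<Delta> r > 0" and \<Delta>max: "\<Delta>max = (MAX r\<in>{1..r0}. \<Delta> r)"
      and wass: "\<forall>p. 1 \<le> p \<and> p \<le> p0 \<longrightarrow> wasserstein p W std_normal_distribution
         \<le> ennreal (A * (MAX r\<in>{1..r0}. rpow p (\<alpha> r) * \<Delta> r))"
      and ln: "\<bar>ln \<Delta>max\<bar> \<le> p0 / 2"
      and x: "0 \<le> x \<and> x \<le> min (sqrt p0) (MIN r\<in>{1..r0}. \<Delta> r powr (- 1 / (2 * \<alpha> r + 1)))"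
    have \<Delta>_le: "\<Delta> r \<le> \<Delta>max" if "r \<in> {1..r0}" for r
      using that by (auto simp: \<Delta>max intro!: Max_ge)
    have x_le: "x \<le> \<Delta> r powr (- 1 / (2 * \<alpha> r + 1))" if r: "r \<in> {1..r0}" for r
    proof -
      have "x \<le> (MIN r\<in>{1..r0}. \<Delta> r powr (- 1 / (2 * \<alpha> r + 1)))"
        using x by simp
      also have "\<dots> \<le> \<Delta> r powr (- 1 / (2 * \<alpha> r + 1))"
        using r by (intro Min_le) auto
      finally show ?thesis .
    qed
    obtain r\<^sub>m where rm: "r\<^sub>m \<in> {1..r0}" "\<Delta> r\<^sub>m = \<Delta>max"
      using Max_in[of "\<Delta> ` {1..r0}"] ne unfolding \<Delta>max by (metis finite_atLeastAtMost
          finite_imageI imageE image_is_empty)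
    then have \<Delta>max_pos: "\<Delta>max > 0"
      using \<Delta> by metis
    define B where "B = (MAX r\<in>{1..r0}. rpow (\<bar>ln \<Delta>max\<bar> + x\<^sup>2) (\<alpha> r) * \<Delta> r)"
    have B_ge: "rpow (\<bar>ln \<Delta>max\<bar> + x\<^sup>2) (\<alpha> r) * \<Delta> r \<le> B" if "r \<in> {1..r0}" for r
      unfolding B_def using that by (intro Max_ge) auto
    have B_nonneg: "B \<ge> 0"
      using B_ge[OF rm(1)] \<Delta>max_pos rpow_nonneg[of "\<bar>ln \<Delta>max\<bar> + x\<^sup>2" "\<alpha> r\<^sub>m"]
      by (metis mult_nonneg_nonneg less_imp_le order_trans rm(2))
    have "\<bar>measure W {x<..} / measure std_normal_distribution {x<..} - 1\<bar>
        \<le> max C1 C2 * (1 + x) * (B + \<Delta>max)"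
    proof (cases "\<Delta>max \<ge> 1")
      case True
      have "x \<le> \<Delta>max powr (- 1 / (2 * \<alpha> r\<^sub>m + 1))"
        using x_le[OF rm(1)] rm(2) by simp
      also have "\<dots> \<le> \<Delta>max powr 0"
        using True assms(2)[OF rm(1)] by (intro powr_mono) (auto simp: field_simps)
      finally have "x \<le> 1"
        using \<Delta>max_pos by simp
      then have "\<bar>measure W {x<..} / measure std_normal_distribution {x<..} - 1\<bar> \<le> C2 * (1 + x) * 1"
        using tail_ratio_le_near_zero[of W x] W x
        by (simp add: C2_def real_distribution_def)
      also have "\<dots> \<le> max C1 C2 * (1 + x) * (B + \<Delta>max)"
        using C x True B_nonneg by (intro mult_mono) auto
      finally show ?thesis .
    next
      case False
      define L where "L = \<bar>ln \<Delta>max\<bar>"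
      have L: "L > 0" "\<Delta>max = exp (- L)"
        using False \<Delta>max_pos by (auto simp: L_def abs_if)
      define p where "p = max 1 (L + x\<^sup>2 / 2)"
      have "x\<^sup>2 \<le> p0"
        using x p0 real_le_rsqrt sqrt_le_D
        by (metis min.boundedE power_mono real_sqrt_pow2 order_trans zero_le_one)
      then have p: "1 \<le> p" "p \<le> p0"
        using ln p0 by (auto simp: p_def L_def)
      define M where "M = (MAX r\<in>{1..r0}. rpow p (\<alpha> r) * \<Delta> r)"
      have M_le: "M \<le> c" if "\<And>r. r \<in> {1..r0} \<Longrightarrow> p powr \<alpha> r * \<Delta> r \<le> c" for c
        unfolding M_def using that ne p by (auto simp: rpow_eq_powr)
      have "0 < rpow p (\<alpha> r\<^sub>m) * \<Delta> r\<^sub>m"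
        using p rm \<Delta>max_pos by (simp add: rpow_eq_powr)
      also have "\<dots> \<le> M"
        unfolding M_def using rm(1) by (intro Max_ge) auto
      finally have M_pos: "M > 0" .
      have MB: "M \<le> B + \<Delta>max"
      proof (rule M_le)
        fix r assume r: "r \<in> {1..r0}"
        have "p powr \<alpha> r * \<Delta> r \<le> (L + x\<^sup>2) powr \<alpha> r * \<Delta> r + \<Delta>max"
          unfolding p_def using r L \<Delta> \<Delta>_le assms(2) by (intro max_one_powr_mult_le) auto
        also have "\<dots> \<le> B + \<Delta>max"
          using B_ge[OF r] L(1) by (simp add: rpow_eq_powr add_pos_nonneg flip: L_def)
        finally show "p powr \<alpha> r * \<Delta> r \<le> B + \<Delta>max" .
      qed
      have xM: "x * M \<le> K"
      proof (cases "x = 0")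
        case True
        have "0 \<le> (2 * \<alpha> r\<^sub>m + 1) powr \<alpha> r\<^sub>m" by simp
        also have "\<dots> \<le> K"
          unfolding K_def using rm(1) by (intro Max_ge) auto
        finally show ?thesis
          using True by simp
      next
        case False
        have "M \<le> K / x"
        proof (rule M_le)
          fix r assume r: "r \<in> {1..r0}"
          have "x * (p powr \<alpha> r * \<Delta> r) \<le> (2 * \<alpha> r + 1) powr \<alpha> r"
            using r L \<Delta> \<Delta>_le x x_le p assms(2)
            by (intro shift_product_bounded[where L = L]) (auto simp: p_def)
          also have "\<dots> \<le> K"
            unfolding K_def using r by (intro Max_ge) auto
          finally show "p powr \<alpha> r * \<Delta> r \<le> K / x"
            using False x by (simp add: field_simps)
        qed
        then show ?thesis
          using False x by (simp add: field_simps)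
      qed
      have "\<bar>measure W {x<..} / measure std_normal_distribution {x<..} - 1\<bar>
          \<le> exp (3 / 2) * (1 + x) * (2 * exp 1 * (A * M) * exp (x * (2 * exp 1 * (A * M)))
             + sqrt (2 * pi) * exp (x\<^sup>2 / 2 - p))"
        using wass p x M_pos \<open>A > 0\<close>
        by (intro tail_ratio_le_of_wasserstein) (auto simp: M_def)
      also have "\<dots> \<le> exp (3 / 2) * (1 + x) * (2 * exp 1 * (A * (B + \<Delta>max)) * exp (2 * exp 1 * A * K)
             + sqrt (2 * pi) * (B + \<Delta>max))"
      proof (intro mult_left_mono add_mono mult_mono)
        have "2 * exp 1 * A * (x * M) \<le> 2 * exp 1 * A * K"
          using xM \<open>A > 0\<close> by (intro mult_left_mono) auto
        then show "exp (x * (2 * exp 1 * (A * M))) \<le> exp (2 * exp 1 * A * K)"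
          by (simp add: mult_ac)
        have "exp (x\<^sup>2 / 2 - p) \<le> \<Delta>max"
          by (simp add: L(2) p_def)
        then show "exp (x\<^sup>2 / 2 - p) \<le> B + \<Delta>max"
          using B_nonneg by linarith
      qed (use MB M_pos \<open>A > 0\<close> B_nonneg \<Delta>max_pos x in auto)
      also have "\<dots> = C1 * (1 + x) * (B + \<Delta>max)"
        unfolding C1_def by algebra
      also have "\<dots> \<le> max C1 C2 * (1 + x) * (B + \<Delta>max)"
        using x B_nonneg \<Delta>max_pos by (intro mult_right_mono) auto
      finally show ?thesis .
    qed
    then show "\<bar>measure W {x<..} / measure std_normal_distribution {x<..} - 1\<bar>
         \<le> max C1 C2 * (1 + x) *
             ((MAX r\<in>{1..r0}. rpow (\<bar>ln \<Delta>max\<bar> + x\<^sup>2) (\<alpha> r) * \<Delta> r) + \<Delta>max)"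
      by (simp add: B_def)
  qed (use C in auto)
qed

end
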